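(* Let $(u_h,\hat u_h,\tilde u_h)\in\mathbb V_h^\Omega\times\mathbb V_h^{\mathcal G}\times\mathbb V_h^{\mathcal B}$ satisfy, for all $(w_h,\hat w_h,\tilde w_h)\in\mathbb V_h^\Omega\times\mathbb V_h^{\mathcal G}\times\mathbb V_h^{\mathcal B}$, $$a_h(u_h,w_h)+\sum_{e\in\mathcal E}b_e(\overline u_{e,h}-\hat u_{e,h},\overline w_{e,h})=(f,w_h)_\Omega,$$ $$\sum_{e\in\mathcal E}a_{e,h}(\hat u_{e,h},\hat w_{e,h})+\sum_{e\in\mathcal E}b_e(\hat u_{e,h}-\overline u_{e,h},\hat w_{e,h})+\sum_{\mathsf v\in\mathcal B}b_{\mathsf v}\big((u_h,\hat u_h,\tilde u_h),(w_h,\hat w_h,\tilde w_h)\big)=\sum_{e\in\mathcal E}(\hat f_e,\hat w_{e,h})_{L^2_{A_e}(e)}.$$ Then the discrete fluxes are conserved at each bifurcation point up to jump terms: $$\sum_{e\in\mathcal E(\mathsf v)}A_e\,\mathrm d_s\hat u_{e,h}(\mathsf v)\,n_e(\mathsf v)+\sum_{e\in\mathcal E(\mathsf v)}\frac{\sigma_{\mathsf v}}{h_e}\big(\hat u_{e,h}(\mathsf v)-\tilde u_{\mathsf v,h}\big)=0,\qquad\forall\,\mathsf v\in\mathcal B.$$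
   Context: Notation. $(f,g)_O$ is the $L^2(O)$ inner product; for a weight $w>0$, $(f,g)_{L^2_w(O)}=(f,wg)_O$. Network. $\mathcal G(\mathcal V,\mathcal E)$ is a finite, directed, connected oriented graph with vertices $\mathcal V$ and edges $\mathcal E$ (one-dimensional segments embedded in a bounded domain $\Omega\subset\mathbb R^3$, each with arc-length variable $s$). $\mathcal E(\mathsf v)$ is the set of edges sharing the vertex $\mathsf v$. For $e=(\mathsf v_{\mathrm{in}}^e,\mathsf v_{\mathrm{out}}^e)$, $n_e:\mathcal V\to\{-1,0,1\}$ is $n_e(\mathsf v_{\mathrm{in}}^e)=1$, $n_e(\mathsf v_{\mathrm{out}}^e)=-1$, $n_e(\mathsf v)=0$ otherwise. Bifurcation points: $\mathcal B=\{\mathsf v\in\mathcal V:\mathrm{card}(\mathcal E(\mathsf v))\ge3\}$. Each edge $e$ is surrounded by a cylinder $B_e$, strictly included in $\Omega$, with cross-section $\Theta_e$ of area $A_e>0$ and perimeter $P_e>0$. $\overline u_e=\frac1{P_e}\int_{\partial\Theta_e}u$. $\xi$ is a positive constant $\xi_e$ on each edge. Data: $f\in L^2(\Omega)$, $\hat f_e\in L^2_{A_e}(e)$. 3D discretization. $\mathcal T_\Omega^h$ is a regular partition of $\Omega$ into tetrahedra such that, for every $e$ and every $K$ meeting $B_e$, $\partial K\cap\partial B_e$ has zero two-dimensional measure. $\mathbb V_h^\Omega=\{v_h\in L^2(\Omega):v_h|_K\in\mathbb P_{k_1}(K)\ \forall K\}$. $\Gamma_h$ is the set of interior faces; each face $F$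 has area $|F|$ and unit normal $\boldsymbol n_F$ pointing from $K_F^1$ to $K_F^2$, $\{v\}=\frac12(v|_{K_F^1}+v|_{K_F^2})$, $[v]=v|_{K_F^1}-v|_{K_F^2}$; on boundary faces $[v]=\{v\}=v|_{K_F^1}$ and $\boldsymbol n_F$ is the outward normal; "$F\in\Gamma_h\cup\partial\Omega$" ranges over all interior and boundary faces. With $\epsilon_1\in\{-1,0,1\}$, $\sigma_\Omega>0$, $a_h(u,v)=\sum_K\int_K\nabla u\cdot\nabla v-\sum_{F\in\Gamma_h\cup\partial\Omega}\int_F\{\nabla u\}\cdot\boldsymbol n_F[v]+\epsilon_1\sum_{F\in\Gamma_h\cup\partial\Omega}\int_F\{\nabla v\}\cdot\boldsymbol n_F[u]+\sum_{F\in\Gamma_h\cup\partial\Omega}\frac{\sigma_\Omega}{|F|^{1/2}}\int_F[u][v]$. 1D discretization. $h_e$ is the length of the edge $e$. Each edge $e$ carries a uniform mesh with nodes $s_0<\dots<s_{N_e}$ and mesh size $\delta_e$; $\mathbb V_h^e$ is the space of discontinuous piecewise polynomials of degree at most $k_e$ on it, and $\mathbb V_h^{\mathcal G}=\{\hat v_h:\hat v_h|_e=\hat v_{e,h}\in\mathbb V_h^e\ \forall e\in\mathcal E\}$. With $[\hat v]_{s_i}=\hat v(s_i^-)-\hat v(s_i^+)$, $\{\hat v\}_{s_i}=\frac12(\hat v(s_i^-)+\hat v(s_i^+))$ at interior nodes, $\epsilon_2\in\{-1,0,1\}$, penalty $\sigma_e>0$, $a_{e,h}(\hat u,\hat v)=\sum_{i=1}^{N_e}\int_{s_{i-1}}^{s_i}A_e\,\mathrm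 d_s\hat u\,\mathrm d_s\hat v-\sum_{i=1}^{N_e-1}\{A_e\mathrm d_s\hat u\}_{s_i}[\hat v]_{s_i}+\epsilon_2\sum_{i=1}^{N_e-1}\{A_e\mathrm d_s\hat v\}_{s_i}[\hat u]_{s_i}+\sum_{i=1}^{N_e-1}\frac{\sigma_e}{\delta_e}[\hat u]_{s_i}[\hat v]_{s_i}$, and $b_e(\hat v,\hat w)=(\xi_e\hat v,\hat w)_{L^2_{P_e}(e)}$. Bifurcation unknowns. $\mathbb V_h^{\mathcal B}=\{\tilde w_h=(\tilde w_{\mathsf v,h})_{\mathsf v\in\mathcal B}:\sum_{\mathsf v\in\mathcal B}\tilde w_{\mathsf v,h}^2<\infty\}$ (real values). For $\mathsf v\in\mathcal B$, with penalty $\sigma_{\mathsf v}>0$, $b_{\mathsf v}((u_h,\hat u_h,\tilde u_h),(w_h,\hat w_h,\tilde w_h))=\sum_{e\in\mathcal E(\mathsf v)}A_e\mathrm d_s\hat u_{e,h}(\mathsf v)n_e(\mathsf v)(\hat w_{e,h}(\mathsf v)-\tilde w_{\mathsf v,h})+\sum_{e\in\mathcal E(\mathsf v)}A_e\mathrm d_s\hat w_{e,h}(\mathsf v)n_e(\mathsf v)(\hat u_{e,h}(\mathsf v)-\tilde u_{\mathsf v,h})+\sum_{e\in\mathcal E(\mathsf v)}\frac{\sigma_{\mathsf v}}{h_e}(\hat u_{e,h}(\mathsf v)-\tilde u_{\mathsf v,h})(\hat w_{e,h}(\mathsf v)-\tilde w_{\mathsf v,h})$. *)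

theory Defs
  imports "HOL-Analysis.Analysis" "Graph_Theory.Digraph_Component"
begin

section \<open>Hausdorff measure\<close>

text \<open>
  Used for dimensions 1 and 2 in real^3: lengths of and integrals over cross-section boundaries,
  areas of cross-sections and mesh faces, face integrals. The factor \<^const>\<open>unit_ball_vol\<close>
  makes it agree with arc length and surface area. (For dimension 0, 0 ^ 0 = 1 would wrongly
  charge the empty set.) That it is a measure on the Borel sets, so that
  \<^const>\<open>measure_of\<close> is not degenerate, is proved at the end of the theory.
\<close>

definition hausdorff_pre :: "nat \<Rightarrow> real \<Rightarrow> 'a::metric_space set \<Rightarrow> ennreal" where
  "hausdorff_pre d \<delta> A =
     (INF U \<in> {U :: nat \<Rightarrow> 'a set. A \<subseteq> (\<Union>i. U i) \<and> (\<forall>i. bounded (U i) \<and> diameter (U i) \<le> \<delta>)}.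
        \<Sum>i. ennreal (unit_ball_vol (real d) * (diameter (U i) / 2) ^ d))"

definition hausdorff_outer :: "nat \<Rightarrow> 'a::metric_space set \<Rightarrow> ennreal" where
  "hausdorff_outer d A = (SUP \<delta> \<in> {0<..}. hausdorff_pre d \<delta> A)"

definition hausdorff_measure :: "nat \<Rightarrow> 'a::metric_space measure" where
  "hausdorff_measure d = measure_of UNIV (sets borel) (hausdorff_outer d)"


section \<open>Weighted L2 spaces\<close>

definition L2_space :: "('a \<Rightarrow> real) \<Rightarrow> 'a::euclidean_space set \<Rightarrow> ('a \<Rightarrow> real) set" where
  "L2_space w S = {f. set_borel_measurable lebesgue S f \<and>
                      set_integrable lebesgue S (\<lambda>x. w x * (f x)\<^sup>2)}"

definition L2_inner :: "'a::euclidean_space set \<Rightarrow> ('a \<Rightarrow> real) \<Rightarrow> ('a \<Rightarrow> real) \<Rightarrow> real" where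
  "L2_inner S f g = (LINT x:S|lebesgue. f x * g x)"

definition L2_weighted_inner ::
  "('a \<Rightarrow> real) \<Rightarrow> 'a::euclidean_space set \<Rightarrow> ('a \<Rightarrow> real) \<Rightarrow> ('a \<Rightarrow> real) \<Rightarrow> real" where
  "L2_weighted_inner w S f g = L2_inner S f (\<lambda>x. w x * g x)"


section \<open>The network and its surrounding cylinders\<close>

definition bounded_domain :: "'a::euclidean_space set \<Rightarrow> bool" where
  "bounded_domain \<Omega> \<longleftrightarrow> open \<Omega> \<and> topological_space_class.connected \<Omega> \<and> bounded \<Omega> \<and> \<Omega> \<noteq> {}"

text \<open>
  Vertices are points of real^3. An edge e is the pair (inlet, outlet) and stands for the straight
  segment between them, with arc length running from 0 at \<open>fst e\<close> to \<open>edge_length e\<close> at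
  \<open>snd e\<close>.
\<close>

type_synonym vertex = "real^3"
type_synonym edge = "vertex \<times> vertex"

definition edge_length :: "edge \<Rightarrow> real" where
  "edge_length e = dist (fst e) (snd e)"

definition edge_dir :: "edge \<Rightarrow> real^3" where
  "edge_dir e = (1 / edge_length e) *\<^sub>R (snd e - fst e)"

definition edge_point :: "edge \<Rightarrow> real \<Rightarrow> real^3" where
  "edge_point e s = fst e + s *\<^sub>R edge_dir e"

definition edge_segment :: "edge \<Rightarrow> (real^3) set" where
  "edge_segment e = closed_segment (fst e) (snd e)"

text \<open>The asymmetry of the edge relation (oriented graph) also excludes loops.\<close>

definition embedded_network :: "(real^3) set \<Rightarrow> vertex pair_pre_digraph \<Rightarrow> bool" where
  "embedded_network \<Omega> G \<longleftrightarrow>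
     pair_fin_digraph G \<and> Digraph_Component.connected (with_proj G) \<and>
     (\<forall>v w. (v, w) \<in> parcs G \<longrightarrow> (w, v) \<notin> parcs G) \<and>
     pverts G \<subseteq> \<Omega> \<and> (\<forall>e \<in> parcs G. edge_segment e \<subseteq> \<Omega>) \<and>
     (\<forall>e \<in> parcs G. \<forall>e' \<in> parcs G. e \<noteq> e' \<longrightarrow>
        edge_segment e \<inter> edge_segment e' \<subseteq> {fst e, snd e} \<inter> {fst e', snd e'})"

definition incident_edges :: "vertex pair_pre_digraph \<Rightarrow> vertex \<Rightarrow> edge set" where
  "incident_edges G v = {e \<in> parcs G. v = fst e \<or> v = snd e}"

definition bifurcations :: "vertex pair_pre_digraph \<Rightarrow> vertex set" where
  "bifurcations G = {v \<in> pverts G. card (incident_edges G v) \<ge> 3}"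

definition edge_sign :: "edge \<Rightarrow> vertex \<Rightarrow> real" where
  "edge_sign e v = (if v = fst e then 1 else if v = snd e then -1 else 0)"

text \<open>
  The cross-section of a cylinder is given as a subset of the plane through the origin orthogonal to
  the edge; its boundary relative to that plane is its \<^const>\<open>rel_frontier\<close>.
\<close>

definition cylinder :: "(edge \<Rightarrow> (real^3) set) \<Rightarrow> edge \<Rightarrow> (real^3) set" where
  "cylinder \<Theta> e = {edge_point e s + x | s x. 0 < s \<and> s < edge_length e \<and> x \<in> \<Theta> e}"

definition cross_area :: "(edge \<Rightarrow> (real^3) set) \<Rightarrow> edge \<Rightarrow> real" where
  "cross_area \<Theta> e = measure (hausdorff_measure 2) (\<Theta> e)"

definition cross_perimeter :: "(edge \<Rightarrow> (real^3) set) \<Rightarrow> edge \<Rightarrow> real" where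
  "cross_perimeter \<Theta> e = measure (hausdorff_measure 1) (rel_frontier (\<Theta> e))"

text \<open>
  Since \<^const>\<open>measure\<close> sends infinite measure to 0, positivity of the perimeter includes its
  finiteness.
\<close>

definition surrounding_cylinders ::
  "(real^3) set \<Rightarrow> vertex pair_pre_digraph \<Rightarrow> (edge \<Rightarrow> (real^3) set) \<Rightarrow> bool" where
  "surrounding_cylinders \<Omega> G \<Theta> \<longleftrightarrow> (\<forall>e \<in> parcs G.
     openin (top_of_set {x. x \<bullet> edge_dir e = 0}) (\<Theta> e) \<and> bounded (\<Theta> e) \<and> 0 \<in> \<Theta> e \<and>
     0 < cross_area \<Theta> e \<and> 0 < cross_perimeter \<Theta> e \<and>
     closure (cylinder \<Theta> e) \<subseteq> \<Omega>)"

definition lateral_average ::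
  "(edge \<Rightarrow> (real^3) set) \<Rightarrow> (real^3 \<Rightarrow> real) \<Rightarrow> edge \<Rightarrow> real \<Rightarrow> real" where
  "lateral_average \<Theta> u e s =
     (1 / cross_perimeter \<Theta> e) *
     (LINT x:rel_frontier (\<Theta> e)|hausdorff_measure 1. u (edge_point e s + x))"


section \<open>The discontinuous Galerkin form in three dimensions\<close>

definition tetrahedral_partition :: "(real^3) set \<Rightarrow> (real^3) set set \<Rightarrow> bool" where
  "tetrahedral_partition \<Omega> T \<longleftrightarrow> triangulation T \<and> (\<forall>K \<in> T. 3 simplex K) \<and> \<Union>T = closure \<Omega>"

definition cylinder_compatible ::
  "vertex pair_pre_digraph \<Rightarrow> (edge \<Rightarrow> (real^3) set) \<Rightarrow> (real^3) set set \<Rightarrow> bool" where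
  "cylinder_compatible G \<Theta> T \<longleftrightarrow> (\<forall>e \<in> parcs G. \<forall>K \<in> T. K \<inter> cylinder \<Theta> e \<noteq> {} \<longrightarrow>
     emeasure (hausdorff_measure 2) (frontier K \<inter> frontier (cylinder \<Theta> e)) = 0)"

definition poly3_upto :: "nat \<Rightarrow> (real^3 \<Rightarrow> real) set" where
  "poly3_upto k = {p. \<exists>c :: nat \<Rightarrow> nat \<Rightarrow> nat \<Rightarrow> real. \<forall>x. p x =
     (\<Sum>i\<le>k. \<Sum>j\<le>k - i. \<Sum>l\<le>k - i - j. c i j l * (x$1)^i * (x$2)^j * (x$3)^l)}"

text \<open>
  Values on the mesh faces are immaterial, so an element of the discrete space is a function that is
  polynomial on the interior of each tetrahedron. Borel (not just Lebesgue) measurability selects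
  representatives for which integrals against Hausdorff measures make sense; each class has one.
\<close>

definition V3 :: "(real^3) set \<Rightarrow> (real^3) set set \<Rightarrow> nat \<Rightarrow> (real^3 \<Rightarrow> real) set" where
  "V3 \<Omega> T k = {v. v \<in> L2_space (\<lambda>_. 1) \<Omega> \<and> set_borel_measurable borel \<Omega> v \<and>
     (\<forall>K \<in> T. \<exists>p \<in> poly3_upto k. \<forall>x \<in> interior K. v x = p x)}"

definition interior_faces :: "(real^3) set set \<Rightarrow> (real^3) set set" where
  "interior_faces T = {F. \<exists>K \<in> T. \<exists>K' \<in> T. K \<noteq> K' \<and> F facet_of K \<and> F facet_of K'}"

definition all_faces :: "(real^3) set set \<Rightarrow> (real^3) set set" where
  "all_faces T = {F. \<exists>K \<in> T. F facet_of K}"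

text \<open>\<open>K1 F\<close> and \<open>K2 F\<close> are the elements sharing F; on boundary faces \<open>K2 F\<close> is unused.\<close>

type_synonym neighbour = "(real^3) set \<Rightarrow> (real^3) set"

definition face_neighbours :: "(real^3) set set \<Rightarrow> neighbour \<Rightarrow> neighbour \<Rightarrow> bool" where
  "face_neighbours T K1 K2 \<longleftrightarrow>
     (\<forall>F \<in> all_faces T. K1 F \<in> T \<and> F facet_of K1 F) \<and>
     (\<forall>F \<in> interior_faces T. K2 F \<in> T \<and> F facet_of K2 F \<and> K1 F \<noteq> K2 F)"

text \<open>
  Unit normal of the face F pointing out of K: the whole of K lies in the half space behind F. With
  \<open>K = K1 F\<close> it points from \<open>K1 F\<close> to \<open>K2 F\<close>, or out of the domain.
\<close>

definition outward_normal :: "(real^3) set \<Rightarrow> (real^3) set \<Rightarrow> real^3" where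
  "outward_normal K F = (THE n. norm n = 1 \<and> (\<forall>x \<in> F. \<forall>y \<in> K. n \<bullet> (y - x) \<le> 0))"

definition elem_trace :: "(real^3) set \<Rightarrow> (real^3 \<Rightarrow> 'b::t2_space) \<Rightarrow> real^3 \<Rightarrow> 'b" where
  "elem_trace K g x = Lim (at x within interior K) g"

definition gradient :: "(real^3 \<Rightarrow> real) \<Rightarrow> real^3 \<Rightarrow> real^3" where
  "gradient u x = (THE D. GDERIV u x :> D)"

definition face_mean :: "(real^3) set set \<Rightarrow> neighbour \<Rightarrow> neighbour \<Rightarrow>
    (real^3 \<Rightarrow> 'b::real_normed_vector) \<Rightarrow> (real^3) set \<Rightarrow> real^3 \<Rightarrow> 'b" where
  "face_mean T K1 K2 g F x =
     (if F \<in> interior_faces T then (1/2) *\<^sub>R (elem_trace (K1 F) g x + elem_trace (K2 F) g x)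
      else elem_trace (K1 F) g x)"

definition face_jump :: "(real^3) set set \<Rightarrow> neighbour \<Rightarrow> neighbour \<Rightarrow>
    (real^3 \<Rightarrow> real) \<Rightarrow> (real^3) set \<Rightarrow> real^3 \<Rightarrow> real" where
  "face_jump T K1 K2 g F x =
     (if F \<in> interior_faces T then elem_trace (K1 F) g x - elem_trace (K2 F) g x
      else elem_trace (K1 F) g x)"

definition normal_flux :: "(real^3) set set \<Rightarrow> neighbour \<Rightarrow> neighbour \<Rightarrow>
    (real^3 \<Rightarrow> real) \<Rightarrow> (real^3) set \<Rightarrow> real^3 \<Rightarrow> real" where
  "normal_flux T K1 K2 u F x = face_mean T K1 K2 (gradient u) F x \<bullet> outward_normal (K1 F) F"

definition a3 :: "(real^3) set set \<Rightarrow> neighbour \<Rightarrow> neighbour \<Rightarrow>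
    real \<Rightarrow> real \<Rightarrow> (real^3 \<Rightarrow> real) \<Rightarrow> (real^3 \<Rightarrow> real) \<Rightarrow> real" where
  "a3 T K1 K2 \<epsilon> \<sigma> u v =
     (\<Sum>K\<in>T. LINT x:K|lebesgue. gradient u x \<bullet> gradient v x)
     - (\<Sum>F\<in>all_faces T. LINT x:F|hausdorff_measure 2.
          normal_flux T K1 K2 u F x * face_jump T K1 K2 v F x)
     + \<epsilon> * (\<Sum>F\<in>all_faces T. LINT x:F|hausdorff_measure 2.
          normal_flux T K1 K2 v F x * face_jump T K1 K2 u F x)
     + (\<Sum>F\<in>all_faces T. \<sigma> / sqrt (measure (hausdorff_measure 2) F) *
          (LINT x:F|hausdorff_measure 2.
             face_jump T K1 K2 u F x * face_jump T K1 K2 v F x))"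


section \<open>The discontinuous Galerkin forms on the network\<close>

definition mesh_size :: "(edge \<Rightarrow> nat) \<Rightarrow> edge \<Rightarrow> real" where
  "mesh_size N e = edge_length e / real (N e)"

definition mesh_node :: "(edge \<Rightarrow> nat) \<Rightarrow> edge \<Rightarrow> nat \<Rightarrow> real" where
  "mesh_node N e i = real i * mesh_size N e"

text \<open>Nodal values are immaterial, as are face values in three dimensions.\<close>

definition V1_edge :: "(edge \<Rightarrow> nat) \<Rightarrow> (edge \<Rightarrow> nat) \<Rightarrow> edge \<Rightarrow> (real \<Rightarrow> real) set" where
  "V1_edge N k e = {v. \<forall>i \<in> {1..N e}. \<exists>p :: real poly. degree p \<le> k e \<and>
     (\<forall>s \<in> {mesh_node N e (i - 1) <..< mesh_node N e i}. v s = poly p s)}"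

definition V1 ::
  "vertex pair_pre_digraph \<Rightarrow> (edge \<Rightarrow> nat) \<Rightarrow> (edge \<Rightarrow> nat) \<Rightarrow> (edge \<Rightarrow> real \<Rightarrow> real) set" where
  "V1 G N k = {v. \<forall>e \<in> parcs G. v e \<in> V1_edge N k e}"

definition node_mean :: "(real \<Rightarrow> real) \<Rightarrow> real \<Rightarrow> real" where
  "node_mean g s = (Lim (at_left s) g + Lim (at_right s) g) / 2"

definition node_jump :: "(real \<Rightarrow> real) \<Rightarrow> real \<Rightarrow> real" where
  "node_jump g s = Lim (at_left s) g - Lim (at_right s) g"

definition a1 :: "(edge \<Rightarrow> (real^3) set) \<Rightarrow> (edge \<Rightarrow> nat) \<Rightarrow> real \<Rightarrow> (edge \<Rightarrow> real) \<Rightarrow> edge \<Rightarrow>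
    (real \<Rightarrow> real) \<Rightarrow> (real \<Rightarrow> real) \<Rightarrow> real" where
  "a1 \<Theta> N \<epsilon> \<sigma> e u v =
     (\<Sum>i=1..N e. LINT s:{mesh_node N e (i - 1)..mesh_node N e i}|lebesgue.
        cross_area \<Theta> e * deriv u s * deriv v s)
     - (\<Sum>i=1..N e - 1. node_mean (\<lambda>s. cross_area \<Theta> e * deriv u s) (mesh_node N e i) *
          node_jump v (mesh_node N e i))
     + \<epsilon> * (\<Sum>i=1..N e - 1. node_mean (\<lambda>s. cross_area \<Theta> e * deriv v s) (mesh_node N e i) *
          node_jump u (mesh_node N e i))
     + (\<Sum>i=1..N e - 1. \<sigma> e / mesh_size N e *
          node_jump u (mesh_node N e i) * node_jump v (mesh_node N e i))"

definition b_edge :: "(edge \<Rightarrow> (real^3) set) \<Rightarrow> (edge \<Rightarrow> real) \<Rightarrow> edge \<Rightarrow>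
    (real \<Rightarrow> real) \<Rightarrow> (real \<Rightarrow> real) \<Rightarrow> real" where
  "b_edge \<Theta> \<xi> e v w =
     L2_weighted_inner (\<lambda>_. cross_perimeter \<Theta> e) {0..edge_length e} (\<lambda>s. \<xi> e * v s) w"


section \<open>Bifurcation points\<close>

definition V0 :: "vertex pair_pre_digraph \<Rightarrow> (vertex \<Rightarrow> real) set" where
  "V0 G = {w. (\<lambda>v. (w v)\<^sup>2) summable_on bifurcations G}"

definition end_trace :: "edge \<Rightarrow> vertex \<Rightarrow> (real \<Rightarrow> real) \<Rightarrow> real" where
  "end_trace e v g =
     (if v = fst e then Lim (at_right 0) g else Lim (at_left (edge_length e)) g)"

type_synonym dg_function = "(real^3 \<Rightarrow> real) \<times> (edge \<Rightarrow> real \<Rightarrow> real) \<times> (vertex \<Rightarrow> real)"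

fun b_vertex :: "vertex pair_pre_digraph \<Rightarrow> (edge \<Rightarrow> (real^3) set) \<Rightarrow> (vertex \<Rightarrow> real) \<Rightarrow> vertex \<Rightarrow>
    dg_function \<Rightarrow> dg_function \<Rightarrow> real" where
  "b_vertex G \<Theta> \<sigma> v (u, u1, u0) (w, w1, w0) =
     (\<Sum>e\<in>incident_edges G v. cross_area \<Theta> e * end_trace e v (deriv (u1 e)) * edge_sign e v *
        (end_trace e v (w1 e) - w0 v))
     + (\<Sum>e\<in>incident_edges G v. cross_area \<Theta> e * end_trace e v (deriv (w1 e)) * edge_sign e v *
        (end_trace e v (u1 e) - u0 v))
     + (\<Sum>e\<in>incident_edges G v. \<sigma> v / edge_length e *
        (end_trace e v (u1 e) - u0 v) * (end_trace e v (w1 e) - w0 v))"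


section \<open>The Hausdorff measure is a measure on the Borel sets\<close>

lemma hausdorff_pre_mono: "A \<subseteq> B \<Longrightarrow> hausdorff_pre d \<delta> A \<le> hausdorff_pre d \<delta> B"
  unfolding hausdorff_pre_def by (rule INF_superset_mono) auto

lemma hausdorff_pre_antimono: "\<delta> \<le> \<epsilon> \<Longrightarrow> hausdorff_pre d \<epsilon> A \<le> hausdorff_pre d \<delta> A"
  unfolding hausdorff_pre_def by (rule INF_superset_mono) (auto intro: order_trans)

lemma hausdorff_pre_empty: "0 < d \<Longrightarrow> 0 < \<delta> \<Longrightarrow> hausdorff_pre d \<delta> {} = 0"
  unfolding hausdorff_pre_def
  by (rule antisym[OF INF_lower2[of "\<lambda>i. {}"]]) (auto simp: power_0_left)

lemma hausdorff_outer_empty: "0 < d \<Longrightarrow> hausdorff_outer d {} = 0"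
  unfolding hausdorff_outer_def by (auto simp: hausdorff_pre_empty intro!: antisym SUP_least)

lemma hausdorff_outer_mono: "A \<subseteq> B \<Longrightarrow> hausdorff_outer d A \<le> hausdorff_outer d B"
  unfolding hausdorff_outer_def by (intro SUP_mono) (auto intro: hausdorff_pre_mono)

lemma hausdorff_pre_le_outer: "0 < \<delta> \<Longrightarrow> hausdorff_pre d \<delta> A \<le> hausdorff_outer d A"
  unfolding hausdorff_outer_def by (rule SUP_upper) auto

lemma hausdorff_pre_UN:
  "hausdorff_pre d \<delta> (\<Union>i. A i) \<le> (\<Sum>i::nat. hausdorff_pre d \<delta> (A i))"
proof (rule ennreal_le_epsilon)
  fix e :: real assume fin: "(\<Sum>i. hausdorff_pre d \<delta> (A i)) < top" and e: "0 < e"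
  let ?c = "\<lambda>S::'a set. ennreal (unit_ball_vol (real d) * (diameter S / 2) ^ d)"
  let ?ok = "\<lambda>i U. A i \<subseteq> (\<Union>j. U j) \<and> (\<forall>j::nat. bounded (U j) \<and> diameter (U j) \<le> \<delta>)"
  have "\<exists>U. ?ok i U \<and> (\<Sum>j. ?c (U j)) \<le> hausdorff_pre d \<delta> (A i) + ennreal (e * (1/2) ^ Suc i)" for i
  proof -
    have "hausdorff_pre d \<delta> (A i) < top"
      using fin by (metis ennreal_suminf_lessD)
    then have "hausdorff_pre d \<delta> (A i) < hausdorff_pre d \<delta> (A i) + ennreal (e * (1/2) ^ Suc i)"
      using e by (auto simp: ennreal_zero_less_mult_iff less_top)
    from this[unfolded hausdorff_pre_def[of d \<delta> "A i"], unfolded INF_less_iff]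
    show ?thesis
      unfolding hausdorff_pre_def by (auto intro: less_imp_le)
  qed
  then obtain U where ok: "\<And>i. ?ok i (U i)"
    and le: "\<And>i. (\<Sum>j. ?c (U i j)) \<le> hausdorff_pre d \<delta> (A i) + ennreal (e * (1/2) ^ Suc i)"
    by metis
  define V where "V n = (case prod_decode n of (i, j) \<Rightarrow> U i j)" for n
  have "hausdorff_pre d \<delta> (\<Union>i. A i) \<le> (\<Sum>n. ?c (V n))"
    unfolding hausdorff_pre_def
  proof (rule INF_lower, safe)
    fix x i assume "x \<in> A i"
    then obtain j where "x \<in> U i j" using ok by blast
    then have "x \<in> V (prod_encode (i, j))" by (simp add: V_def)
    then show "x \<in> (\<Union>n. V n)" by blast
  next
    fix n show "bounded (V n)" "diameter (V n) \<le> \<delta>"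
      using ok by (auto simp: V_def split: prod.split)
  qed
  also have "\<dots> = (\<Sum>i. \<Sum>j. ?c (U i j))"
    using suminf_ennreal_2dimen[of "\<lambda>i. \<Sum>j. ?c (U i j)" "\<lambda>(i, j). ?c (U i j)"]
    by (simp add: V_def o_def case_prod_unfold)
  also have "\<dots> \<le> (\<Sum>i. hausdorff_pre d \<delta> (A i) + ennreal (e * (1/2) ^ Suc i))"
    by (intro suminf_le le summableI)
  also have "\<dots> = (\<Sum>i. hausdorff_pre d \<delta> (A i)) + (\<Sum>i. ennreal (e * (1/2) ^ Suc i))"
    by (intro suminf_add[symmetric] summableI)
  also have "(\<Sum>i. ennreal (e * (1/2) ^ Suc i)) = ennreal e"
    using sums_mult[OF power_half_series, of e] e
    by (intro suminf_ennreal_eq) (auto simp: mult_ac)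
  finally show "hausdorff_pre d \<delta> (\<Union>i. A i) \<le> (\<Sum>i. hausdorff_pre d \<delta> (A i)) + ennreal e" .
qed

lemma hausdorff_outer_UN: "hausdorff_outer d (\<Union>i. A i) \<le> (\<Sum>i::nat. hausdorff_outer d (A i))"
  unfolding hausdorff_outer_def[of d "\<Union>i. A i"]
  by (intro SUP_least order_trans[OF hausdorff_pre_UN] suminf_le summableI hausdorff_pre_le_outer) auto

lemma outer_measure_space_hausdorff: "0 < d \<Longrightarrow> outer_measure_space UNIV (hausdorff_outer d)"
  by (auto simp: outer_measure_space_def positive_def increasing_def countably_subadditive_def
      hausdorff_outer_empty intro: hausdorff_outer_mono hausdorff_outer_UN)

lemma hausdorff_outer_Un:
  assumes "0 < d" shows "hausdorff_outer d (A \<union> B) \<le> hausdorff_outer d A + hausdorff_outer d B"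
proof -
  have "hausdorff_outer d (A \<union> B) \<le> (\<Sum>i. hausdorff_outer d (binaryset A B i))"
    using hausdorff_outer_UN[of d "binaryset A B"] by (simp add: UN_binaryset_eq)
  also have "\<dots> = hausdorff_outer d A + hausdorff_outer d B"
    by (rule suminf_binaryset_eq) (rule hausdorff_outer_empty[OF assms])
  finally show ?thesis .
qed

lemma hausdorff_outer_separated:
  assumes d: "0 < d" and r: "0 < r" and sep: "\<And>x y. x \<in> A \<Longrightarrow> y \<in> B \<Longrightarrow> r \<le> dist x y"
  shows "hausdorff_outer d A + hausdorff_outer d B \<le> hausdorff_outer d (A \<union> B)"
proof -
  let ?c = "\<lambda>S::'a set. ennreal (unit_ball_vol (real d) * (diameter S / 2) ^ d)"
  have small: "hausdorff_pre d \<delta> A + hausdorff_pre d \<delta> B \<le> hausdorff_pre d \<delta> (A \<union> B)"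
    if \<delta>: "0 < \<delta>" "\<delta> < r" for \<delta>
    unfolding hausdorff_pre_def[of d \<delta> "A \<union> B"]
  proof (rule INF_greatest, safe)
    fix U :: "nat \<Rightarrow> 'a set"
    assume cov: "A \<union> B \<subseteq> \<Union> (range U)" and U: "\<forall>i. bounded (U i) \<and> diameter (U i) \<le> \<delta>"
    define V where "V S i = (if U i \<inter> S \<noteq> {} then U i else {})" for S i
    have V: "hausdorff_pre d \<delta> S \<le> (\<Sum>i. ?c (V S i))" if S: "S \<subseteq> \<Union> (range U)" for S
      unfolding hausdorff_pre_def
    proof (rule INF_lower, safe)
      fix x assume "x \<in> S"
      with S obtain i where "x \<in> U i" by blast
      with \<open>x \<in> S\<close> have "x \<in> V S i" by (auto simp: V_def)
      then show "x \<in> (\<Union>i. V S i)" by blast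
    qed (use U \<delta> in \<open>auto simp: V_def\<close>)
    have disj: "U i \<inter> A = {} \<or> U i \<inter> B = {}" for i
    proof (rule ccontr)
      assume "\<not> ?thesis"
      then obtain x y where xy: "x \<in> U i" "x \<in> A" "y \<in> U i" "y \<in> B" by blast
      then have "dist x y \<le> \<delta>"
        using diameter_bounded_bound[of "U i" x y] U by (meson order_trans)
      with sep[of x y] xy \<delta> show False by simp
    qed
    have "hausdorff_pre d \<delta> A + hausdorff_pre d \<delta> B \<le> (\<Sum>i. ?c (V A i)) + (\<Sum>i. ?c (V B i))"
      using cov by (intro add_mono V) auto
    also have "\<dots> = (\<Sum>i. ?c (V A i) + ?c (V B i))"
      by (intro suminf_add summableI)
    also have "\<dots> \<le> (\<Sum>i. ?c (U i))"
      using disj d by (intro suminf_le summableI) (auto simp: V_def power_0_left)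
    finally show "hausdorff_pre d \<delta> A + hausdorff_pre d \<delta> B \<le> (\<Sum>i. ?c (U i))" .
  qed
  have "hausdorff_pre d \<delta> A + hausdorff_pre d \<epsilon> B \<le> hausdorff_outer d (A \<union> B)"
    if "0 < \<delta>" "0 < \<epsilon>" for \<delta> \<epsilon>
  proof -
    define \<eta> where "\<eta> = min (min \<delta> \<epsilon>) (r / 2)"
    have \<eta>: "0 < \<eta>" "\<eta> < r" "\<eta> \<le> \<delta>" "\<eta> \<le> \<epsilon>" using that r by (auto simp: \<eta>_def min_def)
    have "hausdorff_pre d \<delta> A + hausdorff_pre d \<epsilon> B \<le> hausdorff_pre d \<eta> A + hausdorff_pre d \<eta> B"
      by (intro add_mono hausdorff_pre_antimono \<eta>)
    also have "\<dots> \<le> hausdorff_outer d (A \<union> B)"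
      using small[OF \<eta>(1,2)] hausdorff_pre_le_outer[OF \<eta>(1)] order_trans by blast
    finally show ?thesis .
  qed
  then show ?thesis
    unfolding hausdorff_outer_def[of d A] hausdorff_outer_def[of d B]
    by (auto simp flip: ennreal_SUP_add_left simp: ennreal_SUP_add_right intro!: SUP_least)
qed

lemma hausdorff_outer_closed:
  fixes C :: "'a::metric_space set"
  assumes d: "0 < d" and C: "closed C"
  shows "hausdorff_outer d (A \<inter> C) + hausdorff_outer d (A - C) \<le> hausdorff_outer d A"
proof (cases "C = {} \<or> hausdorff_outer d A = top")
  case True
  then show ?thesis using d by (auto simp: hausdorff_outer_empty)
next
  case False
  let ?H = "hausdorff_outer d :: 'a set \<Rightarrow> ennreal"
  from False have ne: "C \<noteq> {}" and fin: "?H A \<noteq> top" by auto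
  define I where "I n = {x \<in> A. 1 / real (n + 1) \<le> infdist x C}" for n :: nat
  define D where "D n = {x \<in> A. 1 / real (n + 2) \<le> infdist x C \<and> infdist x C < 1 / real (n + 1)}" for n :: nat
  have tri: "infdist y C - infdist x C \<le> dist y x" for x y
    using infdist_triangle[of y C x] by simp
  have part: "(\<Sum>k<n. ?H (D (2 * k + p))) \<le> ?H (\<Union>k<n. D (2 * k + p))" for n p
  proof (induction n)
    case (Suc n)
    define r where "r = 1 / real (2 * n + p) - 1 / real (2 * n + p + 1)"
    have "(\<Sum>k<Suc n. ?H (D (2 * k + p))) \<le> ?H (\<Union>k<n. D (2 * k + p)) + ?H (D (2 * n + p))"
      using Suc by (simp add: add_right_mono)
    also have "\<dots> \<le> ?H ((\<Union>k<n. D (2 * k + p)) \<union> D (2 * n + p))"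
    proof (cases "n = 0")
      case True then show ?thesis using d by (simp add: hausdorff_outer_empty)
    next
      case n: False
      show ?thesis
      proof (rule hausdorff_outer_separated[OF d, of r])
        show "0 < r" using n by (auto simp: r_def intro!: divide_strict_left_mono)
        fix x y assume "x \<in> (\<Union>k<n. D (2 * k + p))" and y: "y \<in> D (2 * n + p)"
        then obtain k where k: "k < n" "x \<in> D (2 * k + p)" by auto
        have "1 / real (2 * n + p) \<le> 1 / real (2 * k + p + 2)"
          using k by (intro divide_left_mono) auto
        then show "r \<le> dist x y" using k(2) y tri[of x y] by (auto simp: D_def r_def)
      qed
    qed
    finally show ?case by (simp add: lessThan_Suc Un_commute)
  qed simp
  have "(\<Sum>k. ?H (D (2 * k + p))) \<le> ?H A" for p
  proof (rule suminf_le_const[OF summableI])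
    fix n show "(\<Sum>k<n. ?H (D (2 * k + p))) \<le> ?H A"
      by (rule order_trans[OF part hausdorff_outer_mono]) (auto simp: D_def)
  qed
  then have fin2: "(\<Sum>k. ?H (D (2 * k + p))) < top" for p
    using fin by (metis less_top order_le_less_trans)
  have Dfin: "(\<Sum>n. ?H (D n)) < top"
  proof -
    have "(\<Sum>n<m. ?H (D n)) \<le> (\<Sum>k. ?H (D (2 * k + 0))) + (\<Sum>k. ?H (D (2 * k + 1)))" for m
    proof -
      have "(\<Sum>n<m. ?H (D n)) \<le> (\<Sum>n<2 * m. ?H (D n))" by (intro sum_mono2) auto
      also have "\<dots> = (\<Sum>k<m. ?H (D (2 * k + 0))) + (\<Sum>k<m. ?H (D (2 * k + 1)))"
        by (induction m) (auto simp: ac_simps)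
      also have "\<dots> \<le> (\<Sum>k. ?H (D (2 * k + 0))) + (\<Sum>k. ?H (D (2 * k + 1)))"
        by (intro add_mono sum_le_suminf summableI) auto
      finally show ?thesis .
    qed
    then have "(\<Sum>n. ?H (D n)) \<le> (\<Sum>k. ?H (D (2 * k + 0))) + (\<Sum>k. ?H (D (2 * k + 1)))"
      by (intro suminf_le_const summableI)
    also have "\<dots> < top" using fin2[of 0] fin2[of 1] by simp
    finally show ?thesis .
  qed
  have cover: "A - C \<subseteq> I n \<union> (\<Union>k. D (k + n))" for n
  proof
    fix x assume x: "x \<in> A - C"
    then have pos: "0 < infdist x C"
      using C ne by (metis DiffD2 infdist_nonneg in_closed_iff_infdist_zero less_eq_real_def)
    show "x \<in> I n \<union> (\<Union>k. D (k + n))"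
    proof (cases "1 / real (n + 1) \<le> infdist x C")
      case False
      define m where "m = (LEAST m. 1 / real (m + 1) \<le> infdist x C)"
      have ex: "\<exists>m. 1 / real (m + 1) \<le> infdist x C"
        using reals_Archimedean[OF pos] by (auto simp: field_simps intro: less_imp_le)
      have m: "1 / real (m + 1) \<le> infdist x C"
        unfolding m_def by (rule LeastI_ex[OF ex])
      have mn: "n < m"
      proof (rule ccontr)
        assume "\<not> n < m"
        then have "1 / real (n + 1) \<le> 1 / real (m + 1)" by (intro divide_left_mono) auto
        with m False show False by simp
      qed
      then obtain m' where m': "m = Suc m'" by (cases m) auto
      have "\<not> 1 / real (m' + 1) \<le> infdist x C"
        using not_less_Least[of m' "\<lambda>m. 1 / real (m + 1) \<le> infdist x C"] m' by (simp add: m_def)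
      then have "x \<in> D ((m' - n) + n)" using m m' mn x by (auto simp: D_def)
      then show ?thesis by blast
    qed (use x in \<open>auto simp: I_def\<close>)
  qed
  have step: "?H (A \<inter> C) + ?H (A - C) \<le> ?H A + (\<Sum>k. ?H (D (k + n)))" for n
  proof -
    have "?H (A - C) \<le> ?H (I n) + ?H (\<Union>k. D (k + n))"
      using hausdorff_outer_mono[OF cover] hausdorff_outer_Un[OF d] order_trans by blast
    also have "\<dots> \<le> ?H (I n) + (\<Sum>k. ?H (D (k + n)))"
      by (intro add_left_mono hausdorff_outer_UN)
    finally have "?H (A \<inter> C) + ?H (A - C) \<le> (?H (A \<inter> C) + ?H (I n)) + (\<Sum>k. ?H (D (k + n)))"
      by (simp add: add_left_mono ac_simps)
    also have "?H (A \<inter> C) + ?H (I n) \<le> ?H ((A \<inter> C) \<union> I n)"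
    proof (rule hausdorff_outer_separated[OF d, of "1 / real (n + 1)"])
      fix x y assume "x \<in> A \<inter> C" "y \<in> I n"
      then show "1 / real (n + 1) \<le> dist x y"
        using infdist_le[of x C y] by (auto simp: I_def dist_commute)
    qed simp
    also have "\<dots> \<le> ?H A" by (intro hausdorff_outer_mono) (auto simp: I_def)
    finally show ?thesis by (simp add: add_right_mono)
  qed
  have "(\<lambda>n. \<Sum>k. ?H (D (k + n))) \<longlonglongrightarrow> 0"
  proof -
    define f where "f n = enn2real (?H (D n))" for n
    have lt: "?H (D n) < top" for n using Dfin by (metis ennreal_suminf_lessD)
    have f: "?H (D n) = ennreal (f n)" "0 \<le> f n" for n using lt[of n] by (auto simp: f_def)
    have sf: "summable f"
      using Dfin by (intro summable_suminf_not_top) (auto simp: f)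
    have "(\<Sum>k. ?H (D (k + n))) = ennreal (\<Sum>k. f (k + n))" for n
      unfolding f using sf f by (intro suminf_ennreal2) (auto simp: summable_iff_shift)
    moreover have "(\<lambda>n. \<Sum>k. f (k + n)) \<longlonglongrightarrow> 0" by (rule suminf_exist_split2[OF sf])
    ultimately show ?thesis using tendsto_ennrealI[of _ 0] by force
  qed
  then have "(\<lambda>n. ?H A + (\<Sum>k. ?H (D (k + n)))) \<longlonglongrightarrow> ?H A + 0"
    by (intro tendsto_add tendsto_const)
  then show ?thesis
    using step by (intro LIMSEQ_le_const[where X="\<lambda>n. ?H A + (\<Sum>k. ?H (D (k + n)))"]) auto
qed

lemma space_hausdorff_measure [simp]: "space (hausdorff_measure d) = UNIV"
  and sets_hausdorff_measure [measurable_cong, simp]: "sets (hausdorff_measure d) = sets borel"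
  by (simp_all add: hausdorff_measure_def space_measure_of_conv sets_measure_of_conv
      sets.sigma_sets_eq[of borel, simplified])

theorem emeasure_hausdorff_measure:
  fixes A :: "'a::metric_space set"
  assumes d: "0 < d" and A: "A \<in> sets borel"
  shows "emeasure (hausdorff_measure d) A = hausdorff_outer d A"
proof -
  let ?L = "lambda_system UNIV UNIV (hausdorff_outer d :: 'a set \<Rightarrow> ennreal)"
  interpret P: sigma_algebra UNIV "UNIV :: 'a set set" by (simp add: sigma_algebra_iff2)
  have L: "measure_space UNIV ?L (hausdorff_outer d)"
    by (rule P.caratheodory_lemma[OF outer_measure_space_hausdorff[OF d]])
  then interpret L: sigma_algebra UNIV ?L by (simp add: measure_space_def)
  have cl: "C \<in> ?L" if C: "closed C" for C
  proof -
    have "hausdorff_outer d (x \<inter> C) + hausdorff_outer d (x - C) = hausdorff_outer d x" for x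
    proof (rule antisym[OF hausdorff_outer_closed[OF d C]])
      have "x = (x \<inter> C) \<union> (x - C)" by blast
      then show "hausdorff_outer d x \<le> hausdorff_outer d (x \<inter> C) + hausdorff_outer d (x - C)"
        using hausdorff_outer_Un[OF d, of "x \<inter> C" "x - C"] by simp
    qed
    then show ?thesis by (simp add: P.lambda_system_eq)
  qed
  have "sets borel \<subseteq> ?L"
    unfolding borel_eq_closed using L.sigma_sets_subset[of "Collect closed"] cl
    by (auto simp: sets_measure_of)
  then have "measure_space UNIV (sets borel) (hausdorff_outer d :: 'a set \<Rightarrow> ennreal)"
    using L sets.sigma_algebra_axioms[of "borel :: 'a measure"]
    by (auto simp: measure_space_def positive_def countably_additive_def)
  then show ?thesis
    unfolding hausdorff_measure_def
    using A by (intro emeasure_measure_of_sigma) (auto simp: measure_space_def)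
qed

end

theory Submission
  imports Defs
begin

text \<open>
  Flux conservation at a vertex is the network equation tested against a change of the single
  unknown at that vertex. Comparing two test functions that share their three-dimensional and
  edge parts and differ only in their bifurcation values, every term of the equation cancels
  except the vertex forms, which depend on the bifurcation values in an affine way
  (\<open>b_vertex_diff\<close>). A unit change at one bifurcation point \<open>v\<close> then leaves
  exactly the flux balance at \<open>v\<close>. Taking the discrete solution itself as the common part
  of the two test functions avoids evaluating any of the forms; arbitrary bifurcation values are
  admissible because the network is finite (\<open>V0_eq_UNIV\<close>).
\<close>

lemma finite_bifurcations: "embedded_network \<Omega> G \<Longrightarrow> finite (bifurcations G)"
  unfolding embedded_network_def bifurcations_def
  by (simp add: pair_fin_digraph.axioms pair_fin_digraph.pair_finite_verts)

lemma V0_eq_UNIV: "finite (bifurcations G) \<Longrightarrow> V0 G = UNIV"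
  unfolding V0_def by (auto intro: summable_on_finite)

text \<open>
  The traces of the derivative of the edge test function multiply an expression free of
  the vertex test values, so they cancel in the difference.
\<close>

lemma b_vertex_diff:
  "b_vertex G \<Theta> \<sigma> v (u, u1, u0) (w, w1, w0) - b_vertex G \<Theta> \<sigma> v (u, u1, u0) (w, w1, w0') =
     (w0' v - w0 v) *
     ((\<Sum>e\<in>incident_edges G v. cross_area \<Theta> e * end_trace e v (deriv (u1 e)) * edge_sign e v) +
      (\<Sum>e\<in>incident_edges G v. \<sigma> v / edge_length e * (end_trace e v (u1 e) - u0 v)))"
  by (simp add: distrib_left sum_distrib_left algebra_simps diff_divide_distrib add_divide_distrib
      flip: sum.distrib sum_subtractf)

theorem mainTheorem6:
  fixes \<Omega> :: "(real^3) set" and G :: "vertex pair_pre_digraph"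
    and \<Theta> :: "edge \<Rightarrow> (real^3) set" and \<xi> :: "edge \<Rightarrow> real"
    and f :: "real^3 \<Rightarrow> real" and f1 :: "edge \<Rightarrow> real \<Rightarrow> real"
    and T :: "(real^3) set set" and K1 K2 :: neighbour
    and k3 :: nat and \<epsilon>3 \<sigma>3 :: real
    and N k1 :: "edge \<Rightarrow> nat" and \<epsilon>1 :: real and \<sigma>1 :: "edge \<Rightarrow> real"
    and \<sigma>0 :: "vertex \<Rightarrow> real"
    and u :: "real^3 \<Rightarrow> real" and u1 :: "edge \<Rightarrow> real \<Rightarrow> real" and u0 :: "vertex \<Rightarrow> real"
  assumes "bounded_domain \<Omega>" and "embedded_network \<Omega> G" and "surrounding_cylinders \<Omega> G \<Theta>"
    and "\<forall>e \<in> parcs G. 0 < \<xi> e"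
    and "f \<in> L2_space (\<lambda>_. 1) \<Omega>"
    and "\<forall>e \<in> parcs G. f1 e \<in> L2_space (\<lambda>_. cross_area \<Theta> e) {0..edge_length e}"
    and "tetrahedral_partition \<Omega> T" and "cylinder_compatible G \<Theta> T"
    and "face_neighbours T K1 K2"
    and "\<epsilon>3 \<in> {-1, 0, 1}" and "0 < \<sigma>3"
    and "\<forall>e \<in> parcs G. 1 \<le> N e"
    and "\<epsilon>1 \<in> {-1, 0, 1}" and "\<forall>e \<in> parcs G. 0 < \<sigma>1 e"
    and "\<forall>v \<in> bifurcations G. 0 < \<sigma>0 v"
    and "(u, u1, u0) \<in> V3 \<Omega> T k3 \<times> V1 G N k1 \<times> V0 G"
    and "\<forall>(w, w1, w0) \<in> V3 \<Omega> T k3 \<times> V1 G N k1 \<times> V0 G.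
           a3 T K1 K2 \<epsilon>3 \<sigma>3 u w
           + (\<Sum>e \<in> parcs G. b_edge \<Theta> \<xi> e (\<lambda>s. lateral_average \<Theta> u e s - u1 e s)
                               (lateral_average \<Theta> w e))
           = L2_inner \<Omega> f w"
    and "\<forall>(w, w1, w0) \<in> V3 \<Omega> T k3 \<times> V1 G N k1 \<times> V0 G.
           (\<Sum>e \<in> parcs G. a1 \<Theta> N \<epsilon>1 \<sigma>1 e (u1 e) (w1 e))
           + (\<Sum>e \<in> parcs G. b_edge \<Theta> \<xi> e (\<lambda>s. u1 e s - lateral_average \<Theta> u e s) (w1 e))
           + (\<Sum>v \<in> bifurcations G. b_vertex G \<Theta> \<sigma>0 v (u, u1, u0) (w, w1, w0))
           = (\<Sum>e \<in> parcs G. L2_weighted_inner (\<lambda>_. cross_area \<Theta> e) {0..edge_length e}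
                               (f1 e) (w1 e))"
  shows "\<forall>v \<in> bifurcations G.
           (\<Sum>e \<in> incident_edges G v.
              cross_area \<Theta> e * end_trace e v (deriv (u1 e)) * edge_sign e v)
           + (\<Sum>e \<in> incident_edges G v.
              \<sigma>0 v / edge_length e * (end_trace e v (u1 e) - u0 v))
           = 0"
proof
  fix v assume v: "v \<in> bifurcations G"
  let ?b = "\<lambda>w0 x. b_vertex G \<Theta> \<sigma>0 x (u, u1, u0) (u, u1, w0)"
  let ?w0 = "u0(v := u0 v - 1)"
  let ?flux = "(\<Sum>e \<in> incident_edges G v.
                  cross_area \<Theta> e * end_trace e v (deriv (u1 e)) * edge_sign e v)
               + (\<Sum>e \<in> incident_edges G v.
                  \<sigma>0 v / edge_length e * (end_trace e v (u1 e) - u0 v))"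
  have fin: "finite (bifurcations G)"
    using \<open>embedded_network \<Omega> G\<close> by (rule finite_bifurcations)
  have mem: "u \<in> V3 \<Omega> T k3" "u1 \<in> V1 G N k1" "w0 \<in> V0 G" for w0
    using \<open>(u, u1, u0) \<in> _\<close> V0_eq_UNIV[OF fin] by auto
  note network_eq = assms(18)[rule_format, OF SigmaI[OF mem(1) SigmaI[OF mem(2,3)]], unfolded prod.case]
  have "0 = (\<Sum>x\<in>bifurcations G. ?b ?w0 x) - (\<Sum>x\<in>bifurcations G. ?b u0 x)"
    using network_eq[of ?w0] network_eq[of u0] by linarith
  also have "\<dots> = (\<Sum>x\<in>bifurcations G. ?b ?w0 x - ?b u0 x)"
    by (simp only: sum_subtractf)
  also have "\<dots> = (\<Sum>x\<in>bifurcations G. if x = v then ?flux else 0)"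
    by (intro sum.cong refl) (simp add: b_vertex_diff del: b_vertex.simps)
  also have "\<dots> = ?flux"
    using fin v by simp
  finally show "?flux = 0" by simp
qed

end
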